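(* The non-negative integer solutions $(n,m,k)$ with $n \geq m$ of the Diophantine equation \[ L_n + L_m = J_k \] are exactly \[ (1,0,3),\ (2,0,4),\ (3,1,4),\ (4,3,5),\ (6,2,6),\ (15,1,12). \]
   Context: $(L_n)_{n\geq 0}$ is the Lucas sequence: $L_0=2$, $L_1=1$, $L_{n+2}=L_{n+1}+L_n$ for all $n\geq 0$. $(J_k)_{k\geq 0}$ is the Jacobsthal sequence: $J_0=0$, $J_1=1$, $J_{k+2}=J_{k+1}+2J_k$ for all $k\geq 0$. *)

theory Defs
  imports Complex_Main
begin

fun lucas :: "nat \<Rightarrow> nat" where
  "lucas 0 = 2"
| "lucas (Suc 0) = 1"
| "lucas (Suc (Suc n)) = lucas (Suc n) + lucas n"

fun jacobsthal :: "nat \<Rightarrow> nat" where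
  "jacobsthal 0 = 0"
| "jacobsthal (Suc 0) = 1"
| "jacobsthal (Suc (Suc k)) = jacobsthal (Suc k) + 2 * jacobsthal k"

end

theory Submission
  imports Defs "HOL-Number_Theory.Cong"
begin

text \<open>
  Since \<open>3 * J k = 2^k - (-1)^k\<close>, the equation reads \<open>3 * (L n + L m) + (-1)^k = 2^k\<close>. A finite sieve
  shows that it has no solution with \<open>k \<ge> 13\<close>: for such \<open>k\<close> the right-hand side vanishes modulo
  \<open>2^13\<close>, and combining this with congruences modulo auxiliary primes, whose Lucas periods and
  orders of 2 divide the smooth numbers \<open>N\<close> and \<open>K\<close>, rules out every residue class of \<open>n\<close> and \<open>m\<close>
  modulo \<open>N\<close> and of \<open>k\<close> modulo \<open>K\<close>. The numbers \<open>N\<close> and \<open>K\<close> are built up factor by factor so that only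
  few classes survive at each stage. The class of \<open>(15, 1, 12)\<close> survives every modulus not
  divisible by \<open>2^13\<close>, which is why it is the last one to disappear.
\<close>

section \<open>Doubling identities and the closed form\<close>

text \<open>The form y^2 - x*y - x^2 changes sign when (x, y) moves to (y, x + y), and it equals -5
  at (2, 1).\<close>

lemma lucas_norm:
  "int (lucas (Suc n)) ^ 2 = int (lucas n) * int (lucas (Suc n)) + int (lucas n) ^ 2 - 5 * (-1) ^ n"
  by (induction n) (simp_all add: power2_eq_square algebra_simps)

lemma lucas_double:
  "int (lucas (2 * n)) = int (lucas n) ^ 2 - 2 * (-1) ^ n"
  "int (lucas (Suc (2 * n))) = int (lucas n) * int (lucas (Suc n)) - (-1) ^ n"
proof (induction n)
  case 0
  { case 1 show ?case by simp next case 2 show ?case by simp }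
next
  case (Suc n)
  { case 1
    show ?case using Suc lucas_norm[of n] by simp
  next
    case 2
    show ?case using Suc lucas_norm[of n] by (simp add: power2_eq_square algebra_simps) }
qed

lemma jacobsthal_closed: "3 * int (jacobsthal k) = 2 ^ k - (-1) ^ k"
  by (induction k rule: jacobsthal.induct) simp_all

section \<open>Evaluation modulo \<open>M\<close> by repeated doubling\<close>

text \<open>Fast doubling on two consecutive Lucas numbers, so that large indices take only
  logarithmically many steps; \<open>s\<close> is the sign (-1)^(x div 2).\<close>

function lucas_mod :: "int \<Rightarrow> int \<Rightarrow> int \<times> int" where
  "lucas_mod M x =
    (if x \<le> 0 then (2 mod M, 1 mod M)
     else let (a, b) = lucas_mod M (x div 2); s = (if even (x div 2) then 1 else -1) in
       if even x then ((a * a - 2 * s) mod M, (a * b - s) mod M)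
       else ((a * b - s) mod M, (b * b + 2 * s) mod M))"
  by auto
termination by (relation "measure (\<lambda>(M, x). nat x)") auto

declare lucas_mod.simps [simp del]

function pow2_mod :: "int \<Rightarrow> int \<Rightarrow> int" where
  "pow2_mod M x =
    (if x \<le> 0 then 1 mod M
     else let a = pow2_mod M (x div 2) in (if even x then a * a else 2 * (a * a)) mod M)"
  by auto
termination by (relation "measure (\<lambda>(M, x). nat x)") auto

declare pow2_mod.simps [simp del]

lemma lucas_mod_eq:
  "lucas_mod M x = (int (lucas (nat x)) mod M, int (lucas (Suc (nat x))) mod M)"
proof (induction M x rule: lucas_mod.induct)
  case (1 M x)
  show ?case
  proof (cases "x \<le> 0")
    case True
    then show ?thesis by (subst lucas_mod.simps) simp
  next
    case False
    define h where "h = nat (x div 2)"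
    define A where "A = int (lucas h)"
    define B where "B = int (lucas (Suc h))"
    have IH: "lucas_mod M (x div 2) = (A mod M, B mod M)"
      using 1 False by (simp add: h_def A_def B_def)
    have sgn: "(if even (x div 2) then 1 else -1) = ((-1) ^ h :: int)"
      using False by (simp add: h_def even_nat_iff)
    have L0: "int (lucas (2 * h)) = A * A - 2 * (-1) ^ h"
      and L1: "int (lucas (Suc (2 * h))) = A * B - (-1) ^ h"
      and L2: "int (lucas (Suc (Suc (2 * h)))) = B * B + 2 * (-1) ^ h"
      using lucas_double[of h] lucas_double(1)[of "Suc h"]
      by (simp_all add: A_def B_def power2_eq_square)
    have red: "(A mod M * (A mod M) - c) mod M = (A * A - c) mod M"
      "(A mod M * (B mod M) - c) mod M = (A * B - c) mod M"
      "(B mod M * (B mod M) + c) mod M = (B * B + c) mod M" for c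
      by (metis mod_diff_left_eq mod_mult_eq, metis mod_diff_left_eq mod_mult_eq,
          metis mod_add_left_eq mod_mult_eq)
    show ?thesis
    proof (cases "even x")
      case True
      then have "nat x = 2 * h" using False by (auto simp: h_def)
      then show ?thesis using False True
        by (subst lucas_mod.simps) (simp add: IH Let_def sgn red L0 L1 del: lucas.simps)
    next
      case odd: False
      then have "nat x = Suc (2 * h)" using False by (auto simp: h_def elim!: oddE)
      then show ?thesis using False odd
        by (subst lucas_mod.simps) (simp add: IH Let_def sgn red L1 L2 del: lucas.simps)
    qed
  qed
qed

lemma pow2_mod_eq: "pow2_mod M x = 2 ^ nat x mod M"
proof (induction M x rule: pow2_mod.induct)
  case (1 M x)
  show ?case
  proof (cases "x \<le> 0")
    case True
    then show ?thesis by (subst pow2_mod.simps) simp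
  next
    case False
    define h where "h = nat (x div 2)"
    have IH: "pow2_mod M (x div 2) = 2 ^ h mod M"
      using 1 False by (simp add: h_def)
    show ?thesis
    proof (cases "even x")
      case True
      then have "nat x = h + h" using False by (auto simp: h_def)
      then show ?thesis using False True
        by (subst pow2_mod.simps) (simp add: IH Let_def mod_simps power_add)
    next
      case odd: False
      then have "nat x = Suc (h + h)" using False by (auto simp: h_def elim!: oddE)
      moreover have "2 * (2 ^ h mod M * (2 ^ h mod M)) mod M = 2 * (2 ^ h * 2 ^ h) mod M"
        by (metis mod_mult_eq mod_mult_right_eq)
      ultimately show ?thesis using False odd
        by (subst pow2_mod.simps) (simp add: IH Let_def mod_simps power_add)
    qed
  qed
qed

section \<open>Periodicity and lifting of residue classes\<close>

lemma periodic_add_mult: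
  fixes f :: "nat \<Rightarrow> 'a"
  assumes "\<And>n. f (n + P) = f n"
  shows "f (n + P * t) = f n"
proof (induction t)
  case (Suc t)
  then show ?case using assms[of "n + P * t"] by (simp add: algebra_simps)
qed simp

lemma periodic_cong:
  fixes f :: "nat \<Rightarrow> 'a"
  assumes per: "\<And>n. f (n + nat P) = f n" and "0 < P" "0 \<le> a" "[int n = a] (mod P)"
  shows "f n = f (nat a)"
proof -
  have "[n = nat a] (mod nat P)"
    using assms(2-4) by (simp flip: cong_int_iff)
  then show ?thesis
    unfolding cong_def by (metis per periodic_add_mult mod_mult_div_eq)
qed

text \<open>Two consecutive values determine the whole sequence, so agreement with the tripled
  initial values 2 and 1 at \<open>P\<close> and \<open>Suc P\<close> suffices.\<close>

lemma lucas_period: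
  assumes "[3 * int (lucas P) = 6] (mod M)" "[3 * int (lucas (Suc P)) = 3] (mod M)"
  shows "3 * int (lucas (n + P)) mod M = 3 * int (lucas n) mod M"
proof -
  have "[3 * int (lucas (n + P)) = 3 * int (lucas n)] (mod M)"
  proof (induction n rule: lucas.induct)
    case (3 n)
    from cong_add[OF this] show ?case by (simp add: algebra_simps)
  qed (use assms in simp_all)
  then show ?thesis by (simp add: cong_def)
qed

definition lifts :: "int \<Rightarrow> int \<Rightarrow> int \<Rightarrow> int list" where
  "lifts N q a = map (\<lambda>i. a + N * i) [0..q - 1]"

text \<open>Writing x = a + N * t, the right lift is the one selected by t mod q.\<close>

lemma ex_lift:
  assumes "[x = a] (mod N)" "0 < q"
  shows "\<exists>a' \<in> set (lifts N q a). [x = a'] (mod N * q)"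
proof -
  from assms(1) obtain t where t: "x = a + N * t"
    by (metis cong_iff_lin cong_sym)
  have "N * t = N * (t mod q) + N * q * (t div q)"
    by (metis distrib_left mod_mult_div_eq mult.assoc)
  then have "x - (a + N * (t mod q)) = N * q * (t div q)"
    using t by simp
  then have "[x = a + N * (t mod q)] (mod N * q)"
    by (simp add: cong_iff_dvd_diff)
  moreover have "a + N * (t mod q) \<in> set (lifts N q a)"
    using assms(2) by (auto simp: lifts_def)
  ultimately show ?thesis by blast
qed

section \<open>Residue classes and the sieve test\<close>

type_synonym class3 = "int \<times> int \<times> int"

definition solution :: "nat \<Rightarrow> nat \<Rightarrow> nat \<Rightarrow> bool" where
  "solution n m k \<longleftrightarrow> 13 \<le> k \<and> lucas n + lucas m = jacobsthal k"

text \<open>The bound on \<open>c\<close> keeps it among the exponents from which powers of 2 are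
  known to be periodic modulo \<open>M\<close>.\<close>

definition in_class :: "int \<Rightarrow> int \<Rightarrow> nat \<Rightarrow> nat \<Rightarrow> nat \<Rightarrow> class3 \<Rightarrow> bool" where
  "in_class N K n m k = (\<lambda>(a, b, c). 0 \<le> a \<and> 0 \<le> b \<and> 13 \<le> c \<and>
     [int n = a] (mod N) \<and> [int m = b] (mod N) \<and> [int k = c] (mod K))"

text \<open>The equation is symmetric in \<open>n\<close> and \<open>m\<close>, so one class per unordered pair suffices.\<close>

definition covers :: "int \<Rightarrow> int \<Rightarrow> class3 list \<Rightarrow> bool" where
  "covers N K S \<longleftrightarrow> (\<forall>n m k. solution n m k \<longrightarrow>
     (\<exists>s \<in> set S. in_class N K n m k s \<or> in_class N K m n k s))"

text \<open>The summand 13 makes the powers of 2 periodic modulo even \<open>M\<close> as well. The factor 3 matters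
  when 3 divides \<open>M\<close>: only \<open>3 * lucas n\<close> needs the period \<open>N\<close> modulo \<open>M\<close>.\<close>

definition periods :: "int \<Rightarrow> int \<Rightarrow> int \<Rightarrow> bool" where
  "periods M N K \<longleftrightarrow> 0 < M \<and> even K \<and> (case lucas_mod M N of (x, y) \<Rightarrow>
     3 * x mod M = 6 mod M \<and> 3 * y mod M = 3 mod M) \<and> pow2_mod M (13 + K) = pow2_mod M 13"

text \<open>Both sides are tripled, so that \<open>jacobsthal_res\<close> can use 2^c - (-1)^c
  without a division by 3.\<close>

definition lucas_res :: "int \<Rightarrow> int \<Rightarrow> int" where
  "lucas_res M a = 3 * fst (lucas_mod M a) mod M"

definition jacobsthal_res :: "int \<Rightarrow> int \<Rightarrow> int" where
  "jacobsthal_res M c = (pow2_mod M c - (if even c then 1 else -1)) mod M"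

text \<open>The simplifier also rewrites under abstractions, so the checker is built from partially
  applied named functions, which are unfolded only once all their arguments are known.\<close>

fun tabulate :: "('a \<Rightarrow> 'b) \<Rightarrow> 'a list \<Rightarrow> ('a \<times> 'b) list" where
  "tabulate f [] = []"
| "tabulate f (x # xs) = (x, f x) # tabulate f xs"

lemma set_tabulate: "set (tabulate f xs) = (\<lambda>x. (x, f x)) ` set xs"
  by (induction xs) auto

text \<open>For reduced residues, \<open>d\<close> lies strictly between -M and 2 * M, so it is
  divisible by \<open>M\<close> only if it is 0 or \<open>M\<close>. Looking up both orders reflects
  the symmetry of the equation.\<close>

fun admissible :: "int \<Rightarrow> class3 list \<Rightarrow> int \<times> int \<Rightarrow> int \<times> int \<Rightarrow> int \<times> int \<Rightarrow> bool" where
  "admissible M T (x, u) (y, v) (z, w) =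
    (let d = u + v - w in
      (d \<noteq> 0 \<and> d \<noteq> M) \<or> (x, y, z) \<in> set T \<or> (y, x, z) \<in> set T)"

definition admissible_row where
  "admissible_row M T W xu yv = list_all (admissible M T xu yv) W"

definition admissible_plane where
  "admissible_plane M T V W xu = list_all (admissible_row M T W xu) V"

fun refines_class :: "int \<Rightarrow> int \<Rightarrow> int \<Rightarrow> int \<Rightarrow> int \<Rightarrow> class3 list \<Rightarrow> class3 \<Rightarrow> bool" where
  "refines_class M N K q r T (a, b, c) =
    list_all (admissible_plane M T (tabulate (lucas_res M) (lifts N q b))
        (tabulate (jacobsthal_res M) (lifts K r c)))
      (tabulate (lucas_res M) (lifts N q a))"

definition refines :: "int \<Rightarrow> int \<Rightarrow> int \<Rightarrow> int \<Rightarrow> int \<Rightarrow> class3 list \<Rightarrow> class3 list \<Rightarrow> bool" where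
  "refines M N K q r S T = list_all (refines_class M N K q r T) S"

section \<open>Soundness of one sieve step\<close>

lemma solution_residues:
  assumes "solution n m k" "in_class N K n m k (a, b, c)" "periods M N K" "0 < N" "0 < K"
  shows "lucas_res M a + lucas_res M b - jacobsthal_res M c \<in> {0, M}"
proof -
  from assms(2) have abc: "0 \<le> a" "0 \<le> b" "13 \<le> c" "[int n = a] (mod N)" "[int m = b] (mod N)"
    "[int k = c] (mod K)"
    by (auto simp: in_class_def)
  from assms(3) have M: "0 < M" and "even K"
    and P: "[3 * int (lucas (nat N)) = 6] (mod M)" "[3 * int (lucas (Suc (nat N))) = 3] (mod M)"
    and Q: "2 ^ nat (13 + K) mod M = 2 ^ 13 mod M"
    by (auto simp: periods_def lucas_mod_eq pow2_mod_eq cong_def mod_simps)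
  have luc: "3 * int (lucas n) mod M = lucas_res M a" if "0 \<le> a" "[int n = a] (mod N)" for n a
    using periodic_cong[of "\<lambda>n. 3 * int (lucas n) mod M", OF lucas_period[OF P] assms(4) that]
    by (simp add: lucas_res_def lucas_mod_eq mod_simps)
  have pow: "(2::int) ^ k mod M = 2 ^ nat c mod M"
  proof -
    have "(2::int) ^ (13 + (i + nat K)) mod M = 2 ^ (13 + i) mod M" for i
    proof -
      have "(2::int) ^ (13 + (i + nat K)) = 2 ^ nat (13 + K) * 2 ^ i"
        using assms(5) by (simp add: nat_add_distrib power_add)
      then show ?thesis
        using Q by (metis mod_mult_left_eq power_add)
    qed
    moreover have "[int (k - 13) = c - 13] (mod K)"
      using assms(1) abc(6) cong_diff[OF abc(6) cong_refl[of 13]]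
      by (simp add: solution_def of_nat_diff)
    ultimately have "(2::int) ^ (13 + (k - 13)) mod M = 2 ^ (13 + nat (c - 13)) mod M"
      using periodic_cong[of "\<lambda>i. (2::int) ^ (13 + i) mod M" K "c - 13" "k - 13"] assms(5) abc(3)
      by simp
    moreover have "13 + (k - 13) = k" "13 + nat (c - 13) = nat c"
      using assms(1) abc(3) by (auto simp: solution_def)
    ultimately show ?thesis by simp
  qed
  \<comment> \<open>The sign (-1)^k can be read off the class of \<open>k\<close> because
    \<open>K\<close> is even.\<close>
  have "even c \<longleftrightarrow> even k"
    using abc(6) \<open>even K\<close> by (metis cong_dvd_iff cong_dvd_modulus even_of_nat)
  then have sgn: "(if even c then 1 else -1) = ((-1) ^ k :: int)"
    by simp
  have "3 * int (lucas n) + 3 * int (lucas m) - (2 ^ k - (-1) ^ k) = 0"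
    using assms(1) jacobsthal_closed[of k] by (simp add: solution_def flip: of_nat_add)
  moreover have "[lucas_res M a + lucas_res M b - jacobsthal_res M c
      = 3 * int (lucas n) + 3 * int (lucas m) - (2 ^ k - (-1) ^ k)] (mod M)"
  proof (intro cong_add cong_diff)
    show "[lucas_res M a = 3 * int (lucas n)] (mod M)" "[lucas_res M b = 3 * int (lucas m)] (mod M)"
      by (simp_all add: cong_def flip: luc[OF abc(1,4)] luc[OF abc(2,5)])
    show "[jacobsthal_res M c = 2 ^ k - (-1) ^ k] (mod M)"
      by (simp add: cong_def jacobsthal_res_def pow2_mod_eq sgn mod_diff_left_eq flip: pow)
  qed
  ultimately have dvd: "M dvd lucas_res M a + lucas_res M b - jacobsthal_res M c"
    by (simp add: cong_0_iff)
  have "0 \<le> lucas_res M x \<and> lucas_res M x < M" "0 \<le> jacobsthal_res M x \<and> jacobsthal_res M x < M" for x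
    using M by (simp_all add: lucas_res_def jacobsthal_res_def)
  \<comment> \<open>The bounds are written as multiples of \<open>M\<close> so that \<open>M\<close>
    cancels against \<open>M * t\<close>.\<close>
  from this(1)[of a] this(1)[of b] this(2)[of c]
  have bnd: "M * -1 < lucas_res M a + lucas_res M b - jacobsthal_res M c"
    "lucas_res M a + lucas_res M b - jacobsthal_res M c < M * 2" by linarith+
  from dvd obtain t where t: "lucas_res M a + lucas_res M b - jacobsthal_res M c = M * t" ..
  then have "-1 < t" "t < 2"
    using bnd M by (simp_all only: mult_less_cancel_left_pos)
  then have "t = 0 \<or> t = 1" by linarith
  then show ?thesis using t by auto
qed

text \<open>A solution in a class of \<open>S\<close> lies in one of its lifts. That lift solves the
  equation modulo \<open>M\<close>, so the check puts it into \<open>T\<close>, possibly with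
  \<open>n\<close> and \<open>m\<close> exchanged.\<close>

lemma covers_refine:
  assumes "covers N K S" "periods M (N * q) (K * r)" "refines M N K q r S T"
    and pos: "0 < N" "0 < K" "0 < q" "0 < r"
  shows "covers (N * q) (K * r) T"
  unfolding covers_def
proof (intro allI impI)
  have main: "\<exists>t \<in> set T. in_class (N * q) (K * r) n m k t \<or> in_class (N * q) (K * r) m n k t"
    if sol: "solution n m k" and s: "s \<in> set S" "in_class N K n m k s" for n m k s
  proof -
    obtain a b c where abc: "s = (a, b, c)" by (cases s)
    with s(2) have "0 \<le> a" "0 \<le> b" "13 \<le> c"
      and cong: "[int n = a] (mod N)" "[int m = b] (mod N)" "[int k = c] (mod K)"
      by (auto simp: in_class_def)
    from cong pos obtain x y z where
      xyz: "x \<in> set (lifts N q a)" "y \<in> set (lifts N q b)" "z \<in> set (lifts K r c)"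
      and "[int n = x] (mod N * q)" "[int m = y] (mod N * q)" "[int k = z] (mod K * r)"
      by (meson ex_lift)
    moreover have "0 \<le> x" "0 \<le> y" "13 \<le> z"
      using xyz pos \<open>0 \<le> a\<close> \<open>0 \<le> b\<close> \<open>13 \<le> c\<close> by (auto simp: lifts_def intro: order_trans)
    ultimately have cls: "in_class (N * q) (K * r) n m k (x, y, z)"
      by (simp add: in_class_def)
    have "lucas_res M x + lucas_res M y - jacobsthal_res M z \<in> {0, M}"
      using solution_residues[OF sol cls assms(2)] pos by simp
    then have "(x, y, z) \<in> set T \<or> (y, x, z) \<in> set T"
      using assms(3) s(1) xyz unfolding refines_def abc
      by (fastforce simp: list_all_iff admissible_plane_def admissible_row_def set_tabulate
          Let_def)
    then show ?thesis
    proof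
      assume "(x, y, z) \<in> set T"
      with cls show ?thesis by blast
    next
      assume "(y, x, z) \<in> set T"
      moreover from cls have "in_class (N * q) (K * r) m n k (y, x, z)"
        by (simp add: in_class_def)
      ultimately show ?thesis by blast
    qed
  qed
  fix n m k assume sol: "solution n m k"
  then have sol': "solution m n k" by (simp add: solution_def add.commute)
  from assms(1) sol obtain s where "s \<in> set S" "in_class N K n m k s \<or> in_class N K m n k s"
    by (meson covers_def)
  then show "\<exists>t \<in> set T. in_class (N * q) (K * r) n m k t \<or> in_class (N * q) (K * r) m n k t"
    using main[OF sol] main[OF sol'] by blast
qed

section \<open>The certificate and the bound on \<open>k\<close>\<close>

fun refutes :: "int \<Rightarrow> int \<Rightarrow> class3 list \<Rightarrow> (int \<times> int \<times> int \<times> class3 list) list \<Rightarrow> bool" where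
  "refutes N K S [] \<longleftrightarrow> S = []"
| "refutes N K S ((M, q, r, T) # ps) \<longleftrightarrow>
     0 < q \<and> 0 < r \<and> periods M (N * q) (K * r) \<and> refines M N K q r S T \<and>
     refutes (N * q) (K * r) T ps"

text \<open>Covering passes down the chain to the empty list, which can only cover an empty set of
  solutions.\<close>

lemma refutes_sound:
  assumes "refutes N K S ps" "covers N K S" "0 < N" "0 < K"
  shows "\<not> solution n m k"
  using assms
proof (induction N K S ps rule: refutes.induct)
  case (1 N K S)
  then show ?case by (auto simp: covers_def)
next
  case (2 N K S M q r T ps)
  then show ?case using covers_refine[of N K S M q r T] by simp
qed

text \<open>A row \<open>(M, q, r, T)\<close> passes from \<open>(N, K)\<close> to \<open>(N * q, K * r)\<close> and keeps those lifted classes that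
  solve the equation modulo \<open>M\<close>. The chain comes from a shortest-path search over pairs \<open>(N, K)\<close>,
  the cost being the number of classes to be tested.\<close>

definition certificate :: "(int \<times> int \<times> int \<times> class3 list) list" where
  "certificate = [
    (2, 3, 1, [(1, 0, 13), (1, 0, 14), (2, 0, 13), (2, 0, 14)]),
    (40, 4, 2, [(1, 3, 16), (1, 0, 15), (2, 6, 14), (2, 0, 16), (4, 3, 13), (4, 9, 15),
      (8, 3, 13), (8, 9, 15), (10, 6, 14), (10, 0, 16), (11, 3, 15)]),
    (144, 2, 3, [(1, 3, 16), (1, 15, 24), (2, 6, 18), (2, 12, 20), (2, 18, 18),
      (2, 0, 16), (4, 3, 17), (4, 15, 21), (8, 9, 15), (8, 21, 19), (11, 3, 23),
      (11, 15, 15), (13, 12, 15), (13, 0, 19), (16, 9, 15), (16, 21, 19), (20, 3, 17),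
      (20, 15, 21), (22, 6, 18), (22, 12, 20), (22, 18, 18), (22, 0, 16)]),
    (224, 2, 1, [(1, 15, 24), (2, 6, 18), (2, 42, 18), (4, 3, 17), (8, 45, 19),
      (13, 12, 15), (13, 24, 19), (13, 36, 15), (16, 33, 15), (32, 33, 15),
      (35, 15, 15), (40, 45, 19), (44, 3, 17), (46, 6, 18), (46, 42, 18)]),
    (23, 1, 11, [(1, 15, 144), (2, 6, 138), (2, 42, 138), (4, 3, 137), (8, 45, 139),
      (40, 45, 139), (44, 3, 137), (46, 6, 138), (46, 42, 138)]),
    (27, 1, 3, [(1, 15, 408), (2, 6, 402), (2, 42, 402), (4, 3, 401), (8, 45, 403),
      (40, 45, 403), (44, 3, 401), (46, 6, 402), (46, 42, 402)]),
    (19, 3, 1, [(1, 15, 408), (2, 6, 402), (2, 42, 402), (2, 102, 402), (2, 138, 402),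
      (4, 3, 401), (8, 141, 403), (136, 141, 403), (140, 3, 401), (142, 6, 402),
      (142, 42, 402), (142, 102, 402), (142, 138, 402)]),
    (17, 1, 2, [(1, 15, 804), (2, 6, 798), (2, 42, 798), (2, 102, 798), (2, 138, 798),
      (4, 3, 797), (8, 141, 799), (136, 141, 799), (140, 3, 797), (142, 6, 798),
      (142, 42, 798), (142, 102, 798), (142, 138, 798)]),
    (81, 1, 3, [(1, 15, 2388), (2, 6, 2382), (2, 42, 798), (2, 102, 798),
      (2, 138, 2382), (4, 3, 2381), (8, 141, 2383), (136, 141, 2383), (140, 3, 2381),
      (142, 6, 2382), (142, 42, 798), (142, 102, 798), (142, 138, 2382)]),
    (109, 3, 1, [(1, 15, 2388), (2, 6, 2382), (2, 102, 798), (2, 330, 798),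
      (2, 426, 2382), (4, 3, 2381), (8, 429, 2383), (424, 429, 2383), (428, 3, 2381),
      (430, 6, 2382), (430, 102, 798), (430, 330, 798), (430, 426, 2382)]),
    (1216576, 2, 4, [(1, 15, 9516), (2, 6, 9510), (2, 858, 9510), (8, 861, 9511),
      (856, 861, 9511), (862, 6, 9510), (862, 858, 9510)]),
    (98432, 2, 4, [(1, 15, 38028), (8, 1725, 38023), (1720, 1725, 38023)]),
    (241, 5, 1, [(1, 15, 38028), (8, 8637, 38023), (8632, 8637, 38023)]),
    (164096, 2, 1, [(1, 15, 38028)]),
    (11, 1, 5, [(1, 15, 190092)]),
    (7681, 4, 2, [(1, 15, 380172)]),
    (12289, 4, 8, [(1, 15, 3041292)]),
    (503324672, 2, 1, [])]"

text \<open>The last modulus is 2^13 * 61441. It removes the class of (15, 1, 12) itself because 3 *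
  (L_15 + L_1) + 1 = 2^12 is nonzero modulo 2^13, whereas 2^k vanishes there for k \<ge> 13.\<close>

lemma refutes_certificate: "refutes 1 2 [(0, 0, 13), (0, 0, 14)] certificate"
  unfolding certificate_def refutes.simps by (intro conjI; code_simp)

text \<open>The chain starts from K = 2 because \<open>periods\<close> asks for an even
  \<open>K\<close>; 13 and 14 are the least admissible representatives of the two parities.\<close>

lemma covers_initial: "covers 1 2 [(0, 0, 13), (0, 0, 14)]"
proof -
  have "[int k = 13] (mod 2) \<or> [int k = 14] (mod 2)" for k
    by (simp add: cong_def) presburger
  then show ?thesis by (auto simp: covers_def in_class_def)
qed

lemma solution_index_less: "lucas n + lucas m = jacobsthal k \<Longrightarrow> k < 13"
  using refutes_sound[OF refutes_certificate covers_initial, of n m k]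
  by (auto simp: solution_def)

section \<open>The finite search over small indices\<close>

text \<open>This form of the recurrence rewrites at numerals, where the \<open>Suc\<close> patterns
  do not match.\<close>

lemma lucas_rec: "2 \<le> n \<Longrightarrow> lucas n = lucas (n - 1) + lucas (n - 2)"
  by (cases n rule: lucas.cases) auto

lemma jacobsthal_rec: "2 \<le> k \<Longrightarrow> jacobsthal k = jacobsthal (k - 1) + 2 * jacobsthal (k - 2)"
  by (cases k rule: jacobsthal.cases) auto

definition lucas_table :: "(nat \<times> int) list" where
  "lucas_table =
    [(0, 2), (1, 1), (2, 3), (3, 4), (4, 7), (5, 11), (6, 18), (7, 29), (8, 47),
     (9, 76), (10, 123), (11, 199), (12, 322), (13, 521), (14, 843), (15, 1364)]"

definition jacobsthal_table :: "(nat \<times> int) list" where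
  "jacobsthal_table =
    [(0, 0), (1, 1), (2, 1), (3, 3), (4, 5), (5, 11), (6, 21), (7, 43), (8, 85),
     (9, 171), (10, 341), (11, 683), (12, 1365)]"

lemma lucas_table: "n < 16 \<Longrightarrow> (n, int (lucas n)) \<in> set lucas_table"
proof -
  have "map (\<lambda>n. (n, int (lucas n))) [0..<16] = lucas_table"
    by (simp add: lucas_table_def upt_rec lucas_rec)
  then have "set lucas_table = (\<lambda>n. (n, int (lucas n))) ` {0..<16}"
    by (metis set_map set_upt)
  then show "n < 16 \<Longrightarrow> (n, int (lucas n)) \<in> set lucas_table" by simp
qed

lemma jacobsthal_table: "k < 13 \<Longrightarrow> (k, int (jacobsthal k)) \<in> set jacobsthal_table"
proof -
  have "map (\<lambda>k. (k, int (jacobsthal k))) [0..<13] = jacobsthal_table"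
    by (simp add: jacobsthal_table_def upt_rec jacobsthal_rec)
  then have "set jacobsthal_table = (\<lambda>k. (k, int (jacobsthal k))) ` {0..<13}"
    by (metis set_map set_upt)
  then show "k < 13 \<Longrightarrow> (k, int (jacobsthal k)) \<in> set jacobsthal_table" by simp
qed

definition small_solutions :: "(nat \<times> nat \<times> nat) set" where
  "small_solutions = {(1, 0, 3), (2, 0, 4), (3, 1, 4), (4, 3, 5), (6, 2, 6), (15, 1, 12)}"

lemma small_solutions_complete:
  "list_all (\<lambda>(k, j). list_all (\<lambda>(n, a). list_all (\<lambda>(m, b).
     a + b \<noteq> j \<or> n < m \<or> (n, m, k) \<in> small_solutions) lucas_table) lucas_table) jacobsthal_table"
  by code_simp

text \<open>2207 is L_16, which exceeds J_12 = 1365. Bounding two neighbours at once makes the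
  induction go through.\<close>

lemma lucas_ge: "2207 \<le> lucas (n + 16) \<and> 2207 \<le> lucas (n + 17)"
proof (induction n)
  case 0
  show ?case by (simp add: lucas_rec)
next
  case (Suc n)
  then show ?case using lucas_rec[of "n + 18"] by (simp add: add.commute)
qed

theorem theorem1p2:
  "{(n :: nat, m :: nat, k :: nat). n \<ge> m \<and> lucas n + lucas m = jacobsthal k}
     = {(1, 0, 3), (2, 0, 4), (3, 1, 4), (4, 3, 5), (6, 2, 6), (15, 1, 12)}"
proof -
  have "n < 16" if "lucas n + lucas m = jacobsthal k" for n m k
  proof (rule ccontr)
    assume "\<not> n < 16"
    then have "2207 \<le> lucas n"
      using lucas_ge[of "n - 16"] by simp
    \<comment> \<open>For k \<le> 12 this gives 3 * J_k \<le> 4097, hence J_k < 2207.\<close>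
    moreover have "3 * int (jacobsthal k) \<le> 2 ^ k + 1"
      using jacobsthal_closed[of k] by (cases "even k") auto
    moreover have "(2::int) ^ k \<le> 2 ^ 12"
      using solution_index_less[OF that] by (intro power_increasing) auto
    ultimately show False using that by simp
  qed
  \<comment> \<open>The bound on \<open>m\<close> is the bound on \<open>n\<close> for the equation
    with its summands exchanged.\<close>
  then have bound: "n < 16 \<and> m < 16 \<and> k < 13" if "lucas n + lucas m = jacobsthal k" for n m k
    using that solution_index_less[OF that] by (metis add.commute)
  have "(n, m, k) \<in> small_solutions" if "m \<le> n" "lucas n + lucas m = jacobsthal k" for n m k
  proof -
    have "(n, int (lucas n)) \<in> set lucas_table" "(m, int (lucas m)) \<in> set lucas_table"
      "(k, int (jacobsthal k)) \<in> set jacobsthal_table"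
      using bound[OF that(2)] by (simp_all add: lucas_table jacobsthal_table)
    with small_solutions_complete
    have "int (lucas n) + int (lucas m) \<noteq> int (jacobsthal k) \<or> n < m \<or> (n, m, k) \<in> small_solutions"
      unfolding list_all_iff by (metis (mono_tags, lifting) case_prod_conv)
    then show ?thesis using that by (simp flip: of_nat_add)
  qed
  moreover have "m \<le> n \<and> lucas n + lucas m = jacobsthal k" if "(n, m, k) \<in> small_solutions" for n m k
    using that unfolding small_solutions_def by (auto simp: lucas_rec jacobsthal_rec)
  ultimately have "{(n, m, k). m \<le> n \<and> lucas n + lucas m = jacobsthal k} = small_solutions"
    by blast
  then show ?thesis
    by (simp only: small_solutions_def)
qed

end
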